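(* Let $E$ be a real or complex Banach space and let $\mathcal{T} = (T_t)_{t \in (0,\infty)}$ be a semigroup on $E$ which is locally bounded at $0$. (a) The semigroup $(T_t)_{t \in (0,\infty)}$ converges strongly as $t\to\infty$ if and only if for every $t \in (0,\infty)$ the semigroup $(T_{tn})_{n\in \mathbb{N}}$ converges strongly as $n\to\infty$. (b) The semigroup $(T_t)_{t \in (0,\infty)}$ converges with respect to the operator norm as $t\to\infty$ if and only if for every $t > 0$ the semigroup $(T_{tn})_{n \in \mathbb{N}}$ converges with respect to the operator norm as $n\to\infty$. If the equivalent assertions in (a) or (b) hold, then all occurring limits coincide.
   Context: $\mathbb{N} = \{1,2,\dots\}$. A semigroup $(T_t)_{t \in (0,\infty)}$ on $E$ is a family of bounded linear operators on $E$ with $T_{t+s} = T_tT_s$ for all $s,t > 0$; no continuity in $t$ is assumed. It is locally bounded at $0$ if for one (equivalently, all) $c \in (0,\infty)$ one has $\sup_{t \in (0,c]}\|T_t\| < \infty$. Strong convergence means convergence in the strong operator topology to some bounded linear operator on $E$. *)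

theory Defs
  imports "HOL-Analysis.Analysis"
begin

(* A real or complex Banach space. The library's class banach only provides the real structure, so
   the scalar multiplication by the field 'k is given explicitly and has to be compatible with it.
   Both real and complex are instances of real_normed_field; conversely, by the Gelfand-Mazur
   theorem, every real_normed_field is isometrically isomorphic to one of these two. *)
locale banach_space_over = vector_space smul
  for smul :: "'k::real_normed_field \<Rightarrow> 'a::banach \<Rightarrow> 'a" +
  assumes smul_of_real: "smul (of_real r) x = r *\<^sub>R x"
    and norm_smul: "norm (smul c x) = norm c * norm x"

(* The bounded 'k-linear operators: elements of the type of blinfun are bounded and additive
   already. The operator norm does not depend on whether the scalars are real or complex. *)
definition bounded_operators ::
    "('k::real_normed_field \<Rightarrow> 'a::banach \<Rightarrow> 'a) \<Rightarrow> ('a \<Rightarrow>\<^sub>L 'a) set" where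
  "bounded_operators smul = {A. \<forall>c x. blinfun_apply A (smul c x) = smul c (blinfun_apply A x)}"

(* The values of T outside (0, \<infinity>) are irrelevant. *)
definition operator_semigroup ::
    "('k::real_normed_field \<Rightarrow> 'a::banach \<Rightarrow> 'a) \<Rightarrow> (real \<Rightarrow> 'a \<Rightarrow>\<^sub>L 'a) \<Rightarrow> bool" where
  "operator_semigroup smul T \<longleftrightarrow>
    (\<forall>t>0. T t \<in> bounded_operators smul) \<and>
    (\<forall>t>0. \<forall>s>0. T (t + s) = T t o\<^sub>L T s)"

definition locally_bounded_at_0 :: "(real \<Rightarrow> 'a::banach \<Rightarrow>\<^sub>L 'a) \<Rightarrow> bool" where
  "locally_bounded_at_0 T \<longleftrightarrow> (\<exists>c>0. bdd_above ((\<lambda>t. norm (T t)) ` {0<..c}))"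

definition strong_limit ::
    "('k::real_normed_field \<Rightarrow> 'a::banach \<Rightarrow> 'a) \<Rightarrow> ('i \<Rightarrow> 'a \<Rightarrow>\<^sub>L 'a) \<Rightarrow> ('a \<Rightarrow>\<^sub>L 'a) \<Rightarrow> 'i filter \<Rightarrow> bool"
  where
  "strong_limit smul S L F \<longleftrightarrow> L \<in> bounded_operators smul \<and>
    (\<forall>x. ((\<lambda>i. blinfun_apply (S i) x) \<longlongrightarrow> blinfun_apply L x) F)"

definition norm_limit ::
    "('k::real_normed_field \<Rightarrow> 'a::banach \<Rightarrow> 'a) \<Rightarrow> ('i \<Rightarrow> 'a \<Rightarrow>\<^sub>L 'a) \<Rightarrow> ('a \<Rightarrow>\<^sub>L 'a) \<Rightarrow> 'i filter \<Rightarrow> bool"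
  where
  "norm_limit smul S L F \<longleftrightarrow> L \<in> bounded_operators smul \<and> (S \<longlongrightarrow> L) F"

definition converges_strongly ::
    "('k::real_normed_field \<Rightarrow> 'a::banach \<Rightarrow> 'a) \<Rightarrow> ('i \<Rightarrow> 'a \<Rightarrow>\<^sub>L 'a) \<Rightarrow> 'i filter \<Rightarrow> bool" where
  "converges_strongly smul S F \<longleftrightarrow> (\<exists>L. strong_limit smul S L F)"

definition converges_in_norm ::
    "('k::real_normed_field \<Rightarrow> 'a::banach \<Rightarrow> 'a) \<Rightarrow> ('i \<Rightarrow> 'a \<Rightarrow>\<^sub>L 'a) \<Rightarrow> 'i filter \<Rightarrow> bool" where
  "converges_in_norm smul S F \<longleftrightarrow> (\<exists>L. norm_limit smul S L F)"

lemma banach_space_over_real: "banach_space_over (scaleR :: real \<Rightarrow> 'a::banach \<Rightarrow> 'a)"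
  by unfold_locales (auto simp: algebra_simps)

lemma bounded_operators_real: "bounded_operators (scaleR :: real \<Rightarrow> 'a::banach \<Rightarrow> 'a) = UNIV"
  by (simp add: bounded_operators_def blinfun.scaleR_right)

lemma banach_space_over_complex: "banach_space_over ((*) :: complex \<Rightarrow> complex \<Rightarrow> complex)"
  by unfold_locales (auto simp: algebra_simps norm_mult scaleR_conv_of_real)

end

theory Submission
  imports Defs
begin

text \<open>
  Only the passage from the sequences \<open>T (t n)\<close> to the full semigroup needs an argument. The point is
  that the range of the limit \<open>P\<close> of the powers of one single operator \<open>T 1\<close> already consists of
  common fixed points of the whole semigroup, although nothing is assumed about continuity or measurability in
  \<open>t\<close>. Indeed, on the fixed space of \<open>T 1\<close> the semigroup is periodic, so each \<open>T t\<close> is invertible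
  there and its negative powers are values of \<open>T\<close> at times in \<open>(0, 1]\<close>; local boundedness bounds
  them uniformly. An operator with uniformly bounded negative powers cannot move a non-zero vector
  to \<open>0\<close> by its positive powers, so \<open>T t\<close> can have convergent powers on that space only if it is
  the identity there (\<open>fixed_point_common\<close>).

  Consequently \<open>T r P = P\<close> for all \<open>r > 0\<close>, and therefore \<open>T (n + r) - P = T r (T n - P)\<close>. As \<open>T r\<close>
  is bounded uniformly for \<open>r \<in> (0, 1]\<close>, convergence along the integers gives convergence along the
  reals, both strongly and in norm (\<open>tendsto_at_top_from_integers\<close>). Since \<open>P\<close> is a limit along
  \<open>t \<rightarrow> \<infinity>\<close>, all the sequences \<open>T (t n)\<close> have the same limit \<open>P\<close>.
\<close>

text \<open>
  Applied below with \<open>g t = norm (T t x - z)\<close> and with \<open>g t = norm (T t - P)\<close>, so that strong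
  and norm convergence share one interpolation argument.
\<close>
lemma tendsto_at_top_from_integers:
  fixes g :: "real \<Rightarrow> real"
  assumes nonneg: "\<And>u. 0 \<le> g u"
    and growth: "\<And>n r. \<lbrakk>0 < n; 0 < r; r \<le> 1\<rbrakk> \<Longrightarrow> g (real n + r) \<le> M * g (real n)"
    and lim: "(\<lambda>n. g (real n)) \<longlonglongrightarrow> 0"
  shows "(g \<longlongrightarrow> 0) at_top"
proof (rule tendstoI)
  fix e :: real
  assume "e > 0"
  have "(\<lambda>n. M * g (real n)) \<longlonglongrightarrow> 0"
    using tendsto_mult_right_zero[OF lim] .
  then have "\<forall>\<^sub>F n in sequentially. M * g (real n) < e"
    using \<open>e > 0\<close> order_tendstoD(2) by blast
  then obtain N where N: "\<And>n. n \<ge> N \<Longrightarrow> M * g (real n) < e"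
    by (auto simp: eventually_sequentially)
  have "dist (g u) 0 < e" if u: "u > real N + 2" for u
  proof -
    (* Rounding up and subtracting 1, rather than rounding down, makes the remainder positive:
       the semigroup law says nothing about time 0. *)
    define n where "n = nat (\<lceil>u\<rceil> - 1)"
    have n: "real n = of_int \<lceil>u\<rceil> - 1"
      unfolding n_def using u by (subst of_nat_nat; linarith)
    have r: "0 < u - real n" "u - real n \<le> 1"
      unfolding n by linarith+
    have "real n > real N" using r u by linarith
    then have "0 < n" "n \<ge> N" by linarith+
    with growth[of n "u - real n"] r N[of n] have "g u < e" by simp
    then show ?thesis using nonneg[of u] by simp
  qed
  then show "\<forall>\<^sub>F u in at_top. dist (g u) 0 < e"
    using eventually_gt_at_top[of "real N + 2"] by (rule eventually_mono[rotated])
qed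

locale locally_bounded_semigroup =
  fixes T :: "real \<Rightarrow> 'a::banach \<Rightarrow>\<^sub>L 'a"
  assumes semigroup: "\<lbrakk>0 < t; 0 < s\<rbrakk> \<Longrightarrow> T (t + s) = T t o\<^sub>L T s"
    and locally_bounded: "locally_bounded_at_0 T"
begin

lemma apply_add: "\<lbrakk>0 < t; 0 < s\<rbrakk> \<Longrightarrow> T (t + s) x = T t (T s x)"
  by (simp add: semigroup)

text \<open>
  The semigroup law extends a bound \<open>M\<close> on \<open>(0, c]\<close> by one factor \<open>M\<close> for every further length \<open>c\<close>.
  It is needed because the period \<open>s\<close> in \<open>fixed_point_common\<close> may exceed \<open>c\<close>.
\<close>
lemma bounded_on_intervals:
  obtains M where "\<And>t. \<lbrakk>0 < t; t \<le> b\<rbrakk> \<Longrightarrow> norm (T t) \<le> M"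
proof -
  obtain c M where c: "c > 0" and M: "\<And>t. \<lbrakk>0 < t; t \<le> c\<rbrakk> \<Longrightarrow> norm (T t) \<le> M"
    using locally_bounded unfolding locally_bounded_at_0_def bdd_above_def by fastforce
  have "\<exists>K. \<forall>t. 0 < t \<and> t \<le> c * real (Suc k) \<longrightarrow> norm (T t) \<le> K" for k
  proof (induction k)
    case 0
    then show ?case using M by auto
  next
    case (Suc k)
    then obtain K where K: "\<And>t. \<lbrakk>0 < t; t \<le> c * real (Suc k)\<rbrakk> \<Longrightarrow> norm (T t) \<le> K"
      by blast
    have "norm (T t) \<le> max M (M * K)" if t: "0 < t" "t \<le> c * real (Suc (Suc k))" for t
    proof (cases "t \<le> c")
      case True
      then show ?thesis using M[OF t(1)] by simp
    next
      case False
      then have tc: "0 < t - c" "t - c \<le> c * real (Suc k)"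
        using t by (auto simp: algebra_simps)
      have "norm (T t) \<le> norm (T c) * norm (T (t - c))"
        using semigroup[OF c tc(1)] norm_blinfun_compose[of "T c" "T (t - c)"] by simp
      also have "\<dots> \<le> M * K"
        using K[OF tc] M[OF c] by (intro mult_mono) (auto intro: order_trans[OF norm_ge_zero])
      finally show ?thesis by simp
    qed
    then show ?case by blast
  qed
  moreover obtain k where k: "b / c \<le> real k"
    using real_arch_simple by blast
  have "b \<le> c * real (Suc k)"
    using k c by (simp add: field_simps)
  ultimately obtain K where "\<And>t. \<lbrakk>0 < t; t \<le> b\<rbrakk> \<Longrightarrow> norm (T t) \<le> K"
    by (meson order_trans)
  then show thesis
    using that by blast
qed

lemma limit_of_powers_fixed:
  assumes t: "t > 0" and lim: "(\<lambda>n. T (t * real n) x) \<longlonglongrightarrow> z"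
  shows "T t z = z"
proof (rule LIMSEQ_unique)
  show "(\<lambda>n. T (t * real (Suc n)) x) \<longlonglongrightarrow> z"
    using lim by (rule LIMSEQ_Suc)
  have "(\<lambda>n. T t (T (t * real n) x)) \<longlonglongrightarrow> T t z"
    using lim by (intro tendsto_intros)
  moreover have "\<forall>\<^sub>F n in sequentially. T t (T (t * real n) x) = T (t * real (Suc n)) x"
    using eventually_gt_at_top[of 0]
    by eventually_elim (use t in \<open>simp add: apply_add distrib_left\<close>)
  ultimately show "(\<lambda>n. T (t * real (Suc n)) x) \<longlonglongrightarrow> T t z"
    by (rule Lim_transform_eventually)
qed

lemma fixed_by_multiple:
  assumes t: "t > 0" and fixed: "T t x = x"
  shows "T (t * real (Suc n)) x = x"
proof (induction n)
  case (Suc n)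
  have "T (t * real (Suc (Suc n))) x = T (t * real (Suc n)) (T t x)"
    using t by (subst apply_add[symmetric]) (auto simp: algebra_simps add_pos_nonneg)
  then show ?case using Suc fixed by simp
qed (use fixed in simp)

text \<open>
  The orbit of a fixed point \<open>x\<close> of \<open>T s\<close> is \<open>s\<close>-periodic. If \<open>z\<close> is the limit of \<open>T (t n) x\<close>, then
  \<open>y = x - z\<close> is a fixed point of \<open>T s\<close> too, and \<open>T (t n) y\<close> tends to \<open>0\<close>. Periodicity allows
  to return from \<open>T (t n) y\<close> to \<open>y\<close> in a time in \<open>(0, s]\<close>, at bounded cost, whence \<open>y = 0\<close>.
\<close>
lemma fixed_point_common:
  assumes s: "s > 0" and t: "t > 0" and fixed: "T s x = x"
    and lim: "(\<lambda>n. T (t * real n) x) \<longlonglongrightarrow> z"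
  shows "T t x = x"
proof -
  define y where "y = x - z"
  have z: "T t z = z" using limit_of_powers_fixed[OF t lim] .
  have "T s z = z"
  proof (rule LIMSEQ_unique)
    show "(\<lambda>n. T (t * real n) x) \<longlonglongrightarrow> z" by (rule lim)
    have "(\<lambda>n. T s (T (t * real n) x)) \<longlonglongrightarrow> T s z"
      using lim by (intro tendsto_intros)
    moreover have "\<forall>\<^sub>F n in sequentially. T s (T (t * real n) x) = T (t * real n) x"
      using eventually_gt_at_top[of 0]
    proof eventually_elim
      case (elim n)
      then have "T s (T (t * real n) x) = T (t * real n) (T s x)"
        using s t by (simp add: apply_add[symmetric] add.commute)
      then show ?case by (simp add: fixed)
    qed
    ultimately show "(\<lambda>n. T (t * real n) x) \<longlonglongrightarrow> T s z"
      by (rule Lim_transform_eventually)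
  qed
  then have y: "T s y = y"
    by (simp add: y_def fixed blinfun.diff_right)
  obtain M where M: "\<And>r. \<lbrakk>0 < r; r \<le> s\<rbrakk> \<Longrightarrow> norm (T r) \<le> M"
    using bounded_on_intervals[of s] by blast
  have bound: "norm y \<le> M * norm (T (t * real (Suc n)) x - z)" for n
  proof -
    define u where "u = t * real (Suc n)"
    have u: "u > 0" using t by (simp add: u_def)
    (* s (k + 1) is the first multiple of the period s that lies strictly after u. *)
    define k where "k = nat \<lfloor>u / s\<rfloor>"
    have "real k = of_int \<lfloor>u / s\<rfloor>"
      unfolding k_def using u s by (subst of_nat_nat) auto
    then have "real k \<le> u / s" "u / s < real k + 1"
      by linarith+
    then have r: "0 < s * real (Suc k) - u" "s * real (Suc k) - u \<le> s"
      using s by (auto simp: field_simps)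
    have "y = T (s * real (Suc k)) y"
      using fixed_by_multiple[OF s y] by simp
    also have "\<dots> = T (s * real (Suc k) - u) (T u y)"
      using r u by (subst apply_add[symmetric]) auto
    also have "T u y = T u x - z"
      using fixed_by_multiple[OF t z] by (simp only: u_def y_def blinfun.diff_right)
    finally have "norm y \<le> norm (T (s * real (Suc k) - u)) * norm (T u x - z)"
      using norm_blinfun by metis
    also have "\<dots> \<le> M * norm (T u x - z)"
      using M[OF r] by (rule mult_right_mono) simp
    finally show ?thesis by (simp add: u_def)
  qed
  have "(\<lambda>n. M * norm (T (t * real (Suc n)) x - z)) \<longlonglongrightarrow> 0"
    using LIMSEQ_Suc[OF lim] by (intro tendsto_mult_right_zero tendsto_norm_zero LIM_zero)
  then have "norm y \<le> 0"
    using bound by (intro LIMSEQ_le_const) auto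
  then show ?thesis using z by (simp add: y_def)
qed

text \<open>
  Convergence is required for all starting vectors because it is applied to the limit \<open>z\<close>: this
  vector is fixed by \<open>T 1\<close>, and its own orbit under the powers of \<open>T t\<close> has to converge.
\<close>
lemma limit_of_powers_common_fixed:
  assumes conv: "\<And>t x. t > 0 \<Longrightarrow> convergent (\<lambda>n. T (t * real n) x)"
    and lim: "(\<lambda>n. T (real n) x) \<longlonglongrightarrow> z" and t: "t > 0"
  shows "T t z = z"
proof -
  have "T 1 z = z"
    using limit_of_powers_fixed[of 1 x z] lim by simp
  moreover obtain w where "(\<lambda>n. T (t * real n) z) \<longlonglongrightarrow> w"
    using conv[OF t] by (auto simp: convergent_def)
  ultimately show ?thesis
    using fixed_point_common[of 1 t z w] t by simp
qed

lemma tendsto_common_fixed_point: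
  assumes fixed: "\<And>t. t > 0 \<Longrightarrow> T t z = z"
    and lim: "(\<lambda>n. T (real n) x) \<longlonglongrightarrow> z"
  shows "((\<lambda>t. T t x) \<longlongrightarrow> z) at_top"
proof -
  obtain M where M: "\<And>r. \<lbrakk>0 < r; r \<le> 1\<rbrakk> \<Longrightarrow> norm (T r) \<le> M"
    using bounded_on_intervals[of 1] by blast
  have "((\<lambda>t. norm (T t x - z)) \<longlongrightarrow> 0) at_top"
  proof (rule tendsto_at_top_from_integers)
    fix n :: nat and r :: real
    assume n: "0 < n" and r: "0 < r" "r \<le> 1"
    have "T (real n + r) x - z = T r (T (real n) x - z)"
      using apply_add[of r "real n"] n r by (simp add: fixed blinfun.diff_right add.commute)
    then have "norm (T (real n + r) x - z) \<le> norm (T r) * norm (T (real n) x - z)"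
      using norm_blinfun by metis
    also have "\<dots> \<le> M * norm (T (real n) x - z)"
      using M[OF r] by (rule mult_right_mono) simp
    finally show "norm (T (real n + r) x - z) \<le> M * norm (T (real n) x - z)" .
  qed (use lim in \<open>auto intro!: tendsto_norm_zero LIM_zero\<close>)
  then show ?thesis
    by (simp add: tendsto_norm_zero_iff LIM_zero_iff)
qed

lemma tendsto_common_fixed_operator:
  assumes fixed: "\<And>t. t > 0 \<Longrightarrow> T t o\<^sub>L P = P"
    and lim: "(\<lambda>n. T (real n)) \<longlonglongrightarrow> P"
  shows "(T \<longlongrightarrow> P) at_top"
proof -
  obtain M where M: "\<And>r. \<lbrakk>0 < r; r \<le> 1\<rbrakk> \<Longrightarrow> norm (T r) \<le> M"
    using bounded_on_intervals[of 1] by blast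
  have "((\<lambda>t. norm (T t - P)) \<longlongrightarrow> 0) at_top"
  proof (rule tendsto_at_top_from_integers)
    fix n :: nat and r :: real
    assume n: "0 < n" and r: "0 < r" "r \<le> 1"
    have "T (real n + r) - P = T r o\<^sub>L (T (real n) - P)"
      using semigroup[of r "real n"] n r fixed[of r]
      by (simp add: bounded_bilinear.diff_right[OF bounded_bilinear_blinfun_compose] add.commute)
    then have "norm (T (real n + r) - P) \<le> norm (T r) * norm (T (real n) - P)"
      using norm_blinfun_compose by metis
    also have "\<dots> \<le> M * norm (T (real n) - P)"
      using M[OF r] by (rule mult_right_mono) simp
    finally show "norm (T (real n + r) - P) \<le> M * norm (T (real n) - P)" .
  qed (use lim in \<open>auto intro!: tendsto_norm_zero LIM_zero\<close>)
  then show ?thesis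
    by (simp add: tendsto_norm_zero_iff LIM_zero_iff)
qed

end

lemma filterlim_multiples_at_top:
  fixes t :: real
  assumes "t > 0"
  shows "filterlim (\<lambda>n. t * real n) at_top sequentially"
  using assms by (intro filterlim_tendsto_pos_mult_at_top[OF tendsto_const] filterlim_real_sequentially)

lemma strong_limit_compose:
  assumes "strong_limit smul S L F" and "filterlim h F G"
  shows "strong_limit smul (\<lambda>i. S (h i)) L G"
  using assms by (auto simp: strong_limit_def intro: filterlim_compose)

lemma norm_limit_compose:
  assumes "norm_limit smul S L F" and "filterlim h F G"
  shows "norm_limit smul (\<lambda>i. S (h i)) L G"
  using assms by (auto simp: norm_limit_def intro: filterlim_compose)

lemma norm_limit_imp_strong_limit:
  "norm_limit smul S L F \<Longrightarrow> strong_limit smul S L F"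
  by (auto simp: norm_limit_def strong_limit_def intro: blinfun.tendsto tendsto_const)

lemma strong_limit_unique:
  assumes "F \<noteq> bot" "strong_limit smul S L F" "strong_limit smul S L' F"
  shows "L = L'"
  using assms by (auto simp: strong_limit_def intro!: blinfun_eqI intro: tendsto_unique)

theorem theorem2p1:
  fixes smul :: "'k::real_normed_field \<Rightarrow> 'a::banach \<Rightarrow> 'a"
    and T :: "real \<Rightarrow> 'a \<Rightarrow>\<^sub>L 'a"
  assumes "banach_space_over smul"
    and "operator_semigroup smul T"
    and "locally_bounded_at_0 T"
  shows
    "(converges_strongly smul T at_top \<longleftrightarrow>
        (\<forall>t>0. converges_strongly smul (\<lambda>n. T (t * real n)) sequentially)) \<and>
     (converges_in_norm smul T at_top \<longleftrightarrow>
        (\<forall>t>0. converges_in_norm smul (\<lambda>n. T (t * real n)) sequentially)) \<and>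
     (converges_strongly smul T at_top \<longrightarrow>
        (\<exists>P. (\<forall>L. strong_limit smul T L at_top \<longleftrightarrow> L = P) \<and>
          (\<forall>t>0. \<forall>L. strong_limit smul (\<lambda>n. T (t * real n)) L sequentially \<longleftrightarrow> L = P))) \<and>
     (converges_in_norm smul T at_top \<longrightarrow>
        (\<exists>P. (\<forall>L. norm_limit smul T L at_top \<longleftrightarrow> L = P) \<and>
          (\<forall>t>0. \<forall>L. norm_limit smul (\<lambda>n. T (t * real n)) L sequentially \<longleftrightarrow> L = P) \<and>
          (\<forall>L. strong_limit smul T L at_top \<longleftrightarrow> L = P) \<and>
          (\<forall>t>0. \<forall>L. strong_limit smul (\<lambda>n. T (t * real n)) L sequentially \<longleftrightarrow> L = P)))"
proof -
  interpret locally_bounded_semigroup T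
    using assms(2,3) by unfold_locales (auto simp: operator_semigroup_def)
  have common_fixed: "T t o\<^sub>L P = P"
    if conv: "\<forall>t>0. converges_strongly smul (\<lambda>n. T (t * real n)) sequentially"
      and P: "strong_limit smul (\<lambda>n. T (real n)) P sequentially" and t: "t > 0" for P t
  proof (rule blinfun_eqI)
    fix x
    have pointwise: "convergent (\<lambda>n. T (t * real n) x)" if "t > 0" for t x
      using conv[rule_format, OF that]
      unfolding converges_strongly_def strong_limit_def convergent_def by blast
    have "(\<lambda>n. T (real n) x) \<longlonglongrightarrow> P x"
      using P by (simp add: strong_limit_def)
    then show "(T t o\<^sub>L P) x = P x"
      using limit_of_powers_common_fixed[OF pointwise _ t] by simp
  qed
  have strong: "converges_strongly smul T at_top"
    if conv: "\<forall>t>0. converges_strongly smul (\<lambda>n. T (t * real n)) sequentially"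
  proof -
    obtain P where P: "strong_limit smul (\<lambda>n. T (real n)) P sequentially"
      using conv[rule_format, of 1] by (auto simp: converges_strongly_def)
    have "T t (P x) = P x" if "t > 0" for t x
      using common_fixed[OF conv P that] by (metis blinfun_apply_blinfun_compose)
    then have "strong_limit smul T P at_top"
      using P by (auto simp: strong_limit_def intro: tendsto_common_fixed_point)
    then show ?thesis by (auto simp: converges_strongly_def)
  qed
  have norm: "converges_in_norm smul T at_top"
    if conv: "\<forall>t>0. converges_in_norm smul (\<lambda>n. T (t * real n)) sequentially"
  proof -
    have "\<forall>t>0. converges_strongly smul (\<lambda>n. T (t * real n)) sequentially"
      using conv norm_limit_imp_strong_limit
      unfolding converges_in_norm_def converges_strongly_def by blast
    moreover obtain P where P: "norm_limit smul (\<lambda>n. T (real n)) P sequentially"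
      using conv[rule_format, of 1] by (auto simp: converges_in_norm_def)
    ultimately have "\<And>t. t > 0 \<Longrightarrow> T t o\<^sub>L P = P"
      using common_fixed norm_limit_imp_strong_limit by blast
    then have "norm_limit smul T P at_top"
      using P by (auto simp: norm_limit_def intro: tendsto_common_fixed_operator)
    then show ?thesis by (auto simp: converges_in_norm_def)
  qed
  note strong_seq = strong_limit_compose[OF _ filterlim_multiples_at_top]
  note norm_seq = norm_limit_compose[OF _ filterlim_multiples_at_top]
  have strong_lims: "(\<forall>L. strong_limit smul T L at_top \<longleftrightarrow> L = P) \<and>
      (\<forall>t>0. \<forall>L. strong_limit smul (\<lambda>n. T (t * real n)) L sequentially \<longleftrightarrow> L = P)"
    if "strong_limit smul T P at_top" for P
    using that strong_seq[OF that] strong_limit_unique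
      trivial_limit_at_top_linorder trivial_limit_sequentially by metis
  have norm_lims: "(\<forall>L. norm_limit smul T L at_top \<longleftrightarrow> L = P) \<and>
      (\<forall>t>0. \<forall>L. norm_limit smul (\<lambda>n. T (t * real n)) L sequentially \<longleftrightarrow> L = P)"
    if P: "norm_limit smul T P at_top" for P
    using P norm_seq[OF P] strong_lims[OF norm_limit_imp_strong_limit[OF P]]
      norm_limit_imp_strong_limit by metis
  show ?thesis
  proof (intro conjI iffI)
    assume "\<forall>t>0. converges_strongly smul (\<lambda>n. T (t * real n)) sequentially"
    then show "converges_strongly smul T at_top" by (rule strong)
  next
    assume "\<forall>t>0. converges_in_norm smul (\<lambda>n. T (t * real n)) sequentially"
    then show "converges_in_norm smul T at_top" by (rule norm)
  next
    assume "converges_strongly smul T at_top"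
    then show "\<forall>t>0. converges_strongly smul (\<lambda>n. T (t * real n)) sequentially"
      unfolding converges_strongly_def using strong_seq by blast
  next
    assume "converges_in_norm smul T at_top"
    then show "\<forall>t>0. converges_in_norm smul (\<lambda>n. T (t * real n)) sequentially"
      unfolding converges_in_norm_def using norm_seq by blast
  next
    show "converges_strongly smul T at_top \<longrightarrow>
        (\<exists>P. (\<forall>L. strong_limit smul T L at_top \<longleftrightarrow> L = P) \<and>
          (\<forall>t>0. \<forall>L. strong_limit smul (\<lambda>n. T (t * real n)) L sequentially \<longleftrightarrow> L = P))"
      using strong_lims unfolding converges_strongly_def by blast
  next
    show "converges_in_norm smul T at_top \<longrightarrow>
        (\<exists>P. (\<forall>L. norm_limit smul T L at_top \<longleftrightarrow> L = P) \<and>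
          (\<forall>t>0. \<forall>L. norm_limit smul (\<lambda>n. T (t * real n)) L sequentially \<longleftrightarrow> L = P) \<and>
          (\<forall>L. strong_limit smul T L at_top \<longleftrightarrow> L = P) \<and>
          (\<forall>t>0. \<forall>L. strong_limit smul (\<lambda>n. T (t * real n)) L sequentially \<longleftrightarrow> L = P))"
    proof
      assume "converges_in_norm smul T at_top"
      then obtain P where P: "norm_limit smul T P at_top"
        by (auto simp: converges_in_norm_def)
      show "\<exists>P. (\<forall>L. norm_limit smul T L at_top \<longleftrightarrow> L = P) \<and>
          (\<forall>t>0. \<forall>L. norm_limit smul (\<lambda>n. T (t * real n)) L sequentially \<longleftrightarrow> L = P) \<and>
          (\<forall>L. strong_limit smul T L at_top \<longleftrightarrow> L = P) \<and>
          (\<forall>t>0. \<forall>L. strong_limit smul (\<lambda>n. T (t * real n)) L sequentially \<longleftrightarrow> L = P)"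
        using norm_lims[OF P] strong_lims[OF norm_limit_imp_strong_limit[OF P]]
        by (intro exI[of _ P]) simp
    qed
  qed
qed

end
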